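(* (1) For all $A,B,C\in\widehat{\mathbb{F}_q^\times}$ and $\lambda\in\mathbb{F}_q$, $$\mathbb{P}_D^{(1)}\left[\begin{matrix}A; & B\\ & C\end{matrix};\lambda\right]=\overline{B}(1-\lambda)\,\mathbb{P}_D^{(1)}\left[\begin{matrix}\overline{A}C; & B\\ & C\end{matrix};\frac{\lambda}{\lambda-1}\right]+\delta(1-\lambda)\,J(A,C\overline{AB})$$ $$=\overline{A}(1-\lambda)\,\mathbb{P}_D^{(1)}\left[\begin{matrix}A; & C\overline{B}\\ & C\end{matrix};\frac{\lambda}{\lambda-1}\right]+\delta(1-\lambda)\,J(A,C\overline{AB}),$$ where for $\lambda=1$ the first term in each expression is read as $0$ (since $\overline{B}(0)=\overline{A}(0)=0$). (2) Let $n\ge2$. For all $A,C,B_1,\dots,B_n\in\widehat{\mathbb{F}_q^\times}$ and $\lambda_1,\dots,\lambda_n\in\mathbb{F}_q$ with $\lambda_i\neq1$ for all $i$, $$\mathbb{P}_D^{(n)}\left[\begin{matrix}A; & B_1\ \cdots\ B_n\\ & C\end{matrix};\lambda_1,\dots,\lambda_n\right]=\left(\prod_{i=1}^n\overline{B_i}(1-\lambda_i)\right)\mathbb{P}_D^{(n)}\left[\begin{matrix}\overline{A}C; & B_1\ \cdots\ B_n\\ & C\end{matrix};\frac{\lambda_1}{\lambda_1-1},\dots,\frac{\lambda_n}{\lambda_n-1}\right].$$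
   Context: $\mathbb{F}_q$ is a finite field with $q=p^e$, $p$ an odd prime. $\widehat{\mathbb{F}_q^\times}$ is the group of complex-valued multiplicative characters of $\mathbb{F}_q^\times$; every character $\chi$, including the trivial one, is extended to $\mathbb{F}_q$ by $\chi(0)=0$, and $\overline{\chi}=\chi^{-1}$. For $x\in\mathbb{F}_q$, $\delta(x)=1$ if $x=0$ and $\delta(x)=0$ otherwise. The Jacobi sum is $J(A,B)=\sum_{x\in\mathbb{F}_q}A(x)B(1-x)$. For $n\ge1$ the finite-field Appell-Lauricella period function is $$\mathbb{P}_D^{(n)}\left[\begin{matrix}A; & B_1\ \cdots\ B_n\\ & C\end{matrix};\lambda_1,\dots,\lambda_n\right]=\sum_{y\in\mathbb{F}_q}A(y)\,C\overline{A}(1-y)\,\overline{B_1}(1-\lambda_1y)\cdots\overline{B_n}(1-\lambda_ny).$$ *)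

theory Defs
  imports Complex_Main "HOL-Library.Cardinality" "HOL-Computational_Algebra.Primes"
begin

text \<open>
  A multiplicative character of a finite field is a homomorphism from the group of nonzero
  elements to the nonzero complex numbers. It is represented by its extension by 0 to the
  whole field; this applies to the trivial character too, which is therefore the indicator
  function of the nonzero elements.
\<close>

definition mult_character :: "('a::{finite,field} \<Rightarrow> complex) \<Rightarrow> bool" where
  "mult_character \<chi> \<longleftrightarrow>
     \<chi> 0 = 0 \<and>
     (\<forall>x. x \<noteq> 0 \<longrightarrow> \<chi> x \<noteq> 0) \<and>
     (\<forall>x y. x \<noteq> 0 \<longrightarrow> y \<noteq> 0 \<longrightarrow> \<chi> (x * y) = \<chi> x * \<chi> y)"

text \<open>
  Product and inverse in the character group. Both respect the extension by 0, the inverse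
  because \<open>inverse 0 = 0\<close>.
\<close>

definition char_mult :: "('a::{finite,field} \<Rightarrow> complex) \<Rightarrow> ('a \<Rightarrow> complex) \<Rightarrow> 'a \<Rightarrow> complex"
    (infixl "\<odot>" 70) where
  "(A \<odot> B) x = A x * B x"

definition char_inv :: "('a::{finite,field} \<Rightarrow> complex) \<Rightarrow> 'a \<Rightarrow> complex" where
  "char_inv A x = inverse (A x)"

definition delta :: "'a::{finite,field} \<Rightarrow> complex" where
  "delta x = (if x = 0 then 1 else 0)"

definition jacobi_sum :: "('a::{finite,field} \<Rightarrow> complex) \<Rightarrow> ('a \<Rightarrow> complex) \<Rightarrow> complex" where
  "jacobi_sum A B = (\<Sum>x\<in>UNIV. A x * B (1 - x))"

text \<open>
  The families \<open>B\<close> and \<open>l\<close> are indexed by \<open>1, \<dots>, n\<close>; values at other indices are irrelevant.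
\<close>

definition lauricella_period ::
    "nat \<Rightarrow> ('a::{finite,field} \<Rightarrow> complex) \<Rightarrow> (nat \<Rightarrow> 'a \<Rightarrow> complex) \<Rightarrow> ('a \<Rightarrow> complex) \<Rightarrow>
     (nat \<Rightarrow> 'a) \<Rightarrow> complex" where
  "lauricella_period n A B C l =
     (\<Sum>y\<in>UNIV. A y * (C \<odot> char_inv A) (1 - y) * (\<Prod>i=1..n. char_inv (B i) (1 - l i * y)))"

end

theory Submission
  imports Defs
begin

text \<open>
  Both transformations are changes of variable in the period sum. The first is
  \<open>y \<mapsto> 1 - y\<close>, under which \<open>1 - \<lambda> y\<close> becomes
  \<open>(1 - \<lambda>) (1 - \<mu> y)\<close> with \<open>\<mu> = \<lambda> / (\<lambda> - 1)\<close>. The second is the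
  fractional linear map \<open>y = z / ((1 - \<lambda>) (1 - \<mu> z))\<close>, which fixes 0 and 1 and satisfies
  \<open>1 - \<lambda> y = 1 / (1 - \<mu> z)\<close>; the summands vanish at its pole and at the point
  missing from its image. For \<open>\<lambda> = 1\<close> the period sum is itself a Jacobi sum.
\<close>

lemma mult_character_zero: "mult_character \<chi> \<Longrightarrow> \<chi> 0 = 0"
  by (simp add: mult_character_def)

lemma mult_character_nonzero: "mult_character \<chi> \<Longrightarrow> x \<noteq> 0 \<Longrightarrow> \<chi> x \<noteq> 0"
  by (simp add: mult_character_def)

lemma mult_character_mult:
  assumes "mult_character \<chi>"
  shows "\<chi> (x * y) = \<chi> x * \<chi> y"
  using assms unfolding mult_character_def by (cases "x = 0"; cases "y = 0") auto

lemma mult_character_one: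
  assumes "mult_character \<chi>"
  shows "\<chi> 1 = 1"
  using mult_character_mult[OF assms, of 1 1] mult_character_nonzero[OF assms, of 1] by simp

lemma mult_character_divide:
  assumes "mult_character \<chi>"
  shows "\<chi> (x / y) = \<chi> x / \<chi> y"
proof (cases "y = 0")
  case True
  then show ?thesis using assms by (simp add: mult_character_zero)
next
  case False
  then have "\<chi> (x / y) * \<chi> y = \<chi> x"
    by (simp flip: mult_character_mult[OF assms])
  then show ?thesis
    using mult_character_nonzero[OF assms False] by (simp add: field_simps)
qed

text \<open>The reflection does not involve the parameters \<open>l i\<close>, so it transforms all
  factors at once. Hence arbitrary \<open>n\<close>: the case \<open>n = 1\<close> gives the first
  identity of part (1), and \<open>n \<ge> 2\<close> is part (2).\<close>

lemma lauricella_period_reflect: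
  fixes A C :: "'a::{finite,field} \<Rightarrow> complex"
  assumes A: "mult_character A" and C: "mult_character C"
    and B: "\<forall>i\<in>{1..n}. mult_character (B i)"
    and l: "\<forall>i\<in>{1..n}. l i \<noteq> 1"
  shows "lauricella_period n A B C l =
    (\<Prod>i=1..n. char_inv (B i) (1 - l i)) *
      lauricella_period n (char_inv A \<odot> C) B C (\<lambda>i. l i / (l i - 1))"
proof -
  have "lauricella_period n A B C l =
      (\<Sum>y\<in>UNIV. A (1 - y) * (C \<odot> char_inv A) y * (\<Prod>i=1..n. char_inv (B i) (1 - l i * (1 - y))))"
    unfolding lauricella_period_def
    by (rule sum.reindex_bij_witness[of _ "\<lambda>y. 1 - y" "\<lambda>y. 1 - y"]) auto
  also have "\<dots> = (\<Sum>y\<in>UNIV. (\<Prod>i=1..n. char_inv (B i) (1 - l i)) *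
      ((char_inv A \<odot> C) y * (C \<odot> char_inv (char_inv A \<odot> C)) (1 - y) *
       (\<Prod>i=1..n. char_inv (B i) (1 - l i / (l i - 1) * y))))"
  proof (rule sum.cong)
    fix y :: 'a
    have "char_inv (B i) (1 - l i * (1 - y)) =
        char_inv (B i) (1 - l i) * char_inv (B i) (1 - l i / (l i - 1) * y)" if "i \<in> {1..n}" for i
    proof -
      have "l i - 1 \<noteq> 0" using l that by auto
      then have "1 - l i * (1 - y) = (1 - l i) * (1 - l i / (l i - 1) * y)"
        by (simp add: field_simps)
      then show ?thesis
        using B that by (simp add: char_inv_def mult_character_mult)
    qed
    then have "(\<Prod>i=1..n. char_inv (B i) (1 - l i * (1 - y))) =
        (\<Prod>i=1..n. char_inv (B i) (1 - l i)) * (\<Prod>i=1..n. char_inv (B i) (1 - l i / (l i - 1) * y))"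
      by (simp add: prod.distrib)
    \<comment> \<open>\<open>C\<close> cancels away from 0. At \<open>1 - y = 0\<close> both sides
      vanish, by the extension by 0.\<close>
    moreover have "(C \<odot> char_inv (char_inv A \<odot> C)) (1 - y) = A (1 - y)"
      using mult_character_nonzero[OF C, of "1 - y"] mult_character_zero[OF A]
        mult_character_zero[OF C]
      by (cases "1 - y = 0") (auto simp: char_mult_def char_inv_def)
    ultimately show "A (1 - y) * (C \<odot> char_inv A) y *
        (\<Prod>i=1..n. char_inv (B i) (1 - l i * (1 - y))) =
      (\<Prod>i=1..n. char_inv (B i) (1 - l i)) *
      ((char_inv A \<odot> C) y * (C \<odot> char_inv (char_inv A \<odot> C)) (1 - y) *
       (\<Prod>i=1..n. char_inv (B i) (1 - l i / (l i - 1) * y)))"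
      by (simp add: char_mult_def)
  qed simp
  finally show ?thesis
    by (simp add: lauricella_period_def sum_distrib_left)
qed

text \<open>With \<open>d = 1 - l + l * z\<close> the substitution is \<open>y = z / d\<close>. Both
  formulas then follow from \<open>d - z = (1 - l) * (1 - z)\<close> and
  \<open>d - l * z = 1 - l\<close>.\<close>

lemma moebius_substitution:
  fixes l z :: "'a::field"
  assumes "l \<noteq> 1" and "1 - l / (l - 1) * z \<noteq> 0"
  defines "y \<equiv> z / ((1 - l) * (1 - l / (l - 1) * z))"
  shows "1 - y = (1 - z) / (1 - l / (l - 1) * z)"
    and "1 - l * y = 1 / (1 - l / (l - 1) * z)"
proof -
  have l: "1 - l \<noteq> 0" "l - 1 \<noteq> 0" using assms(1) by auto
  define d where "d = (1 - l) * (1 - l / (l - 1) * z)"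
  have d: "d = 1 - l + l * z" "d \<noteq> 0"
    using l assms(2) by (simp add: d_def field_simps) (use l assms(2) in \<open>simp add: d_def\<close>)
  have w: "1 - l / (l - 1) * z = d / (1 - l)" using l by (simp add: d_def)
  have y: "y = z / d" by (simp add: y_def d_def)
  show "1 - y = (1 - z) / (1 - l / (l - 1) * z)"
    unfolding w y using d(2) l by (simp add: divide_simps) (simp add: d(1) algebra_simps)
  show "1 - l * y = 1 / (1 - l / (l - 1) * z)"
    unfolding w y using d(2) l by (simp add: divide_simps) (simp add: d(1) algebra_simps)
qed

text \<open>Powers of \<open>w = 1 - m * z\<close>, where \<open>m = l / (l - 1)\<close>, are
  collected: \<open>A y\<close> contributes \<open>1 / A w\<close>, the factor at
  \<open>1 - y\<close> contributes \<open>A w / C w\<close>, and the factor at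
  \<open>1 - l * y\<close> contributes \<open>B w\<close>. The values \<open>A w\<close> cancel, and
  \<open>B w / C w\<close> is the inverse of \<open>C \<odot> char_inv B\<close> at
  \<open>w\<close>. The denominator of \<open>y\<close> also leaves
  \<open>char_inv A (1 - l)\<close> in front.\<close>

lemma lauricella_period_moebius:
  fixes A B C :: "'a::{finite,field} \<Rightarrow> complex"
  assumes A: "mult_character A" and B: "mult_character B" and C: "mult_character C"
    and l: "l \<noteq> 1"
  shows "lauricella_period 1 A (\<lambda>_. B) C (\<lambda>_. l) =
    char_inv A (1 - l) * lauricella_period 1 A (\<lambda>_. C \<odot> char_inv B) C (\<lambda>_. l / (l - 1))"
proof -
  define m where "m = l / (l - 1)"
  define f where "f y = A y * (C \<odot> char_inv A) (1 - y) * char_inv B (1 - l * y)" for y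
  define g where "g z = char_inv A (1 - l) *
    (A z * (C \<odot> char_inv A) (1 - z) * char_inv (C \<odot> char_inv B) (1 - m * z))" for z
  have l': "1 - l \<noteq> 0" "l - 1 \<noteq> 0" using l by auto
  \<comment> \<open>Every character, even the trivial one, is 0 at 0, and
    \<open>inverse 0 = 0\<close>. So both sums may be restricted to the sets on which the fractional
    linear map is a bijection.\<close>
  have f0: "f y = 0" if "1 - l * y = 0" for y
    using that B by (simp add: f_def char_inv_def mult_character_zero)
  have g0: "g z = 0" if "1 - m * z = 0" for z
    using that C by (simp add: g_def char_inv_def char_mult_def mult_character_zero)
  \<comment> \<open>The map \<open>l \<mapsto> l / (l - 1)\<close> is an involution that inverts
    \<open>1 - l\<close>. The inverse change of variable is therefore the same substitution with
    \<open>m\<close> in place of \<open>l\<close>, and \<open>sub'\<close> is its instance.\<close>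
  have m1: "1 - m = 1 / (1 - l)" "m / (m - 1) = l" "m \<noteq> 1"
    using l' by (simp_all add: m_def divide_simps)
  note sub = moebius_substitution[OF l, folded m_def]
  note sub' = moebius_substitution[OF m1(3), unfolded m1(1,2)]
  have "sum f UNIV = sum f {y. 1 - l * y \<noteq> 0}"
    by (rule sum.mono_neutral_right) (use f0 in auto)
  also have "\<dots> = sum g {z. 1 - m * z \<noteq> 0}"
  proof (rule sum.reindex_bij_witness
      [of _ "\<lambda>z. z / ((1 - l) * (1 - m * z))" "\<lambda>y. y / (1 / (1 - l) * (1 - l * y))"])
    fix y assume "y \<in> {y. 1 - l * y \<noteq> 0}"
    then have y: "1 - l * y \<noteq> 0" by simp
    define z where "z = y / (1 / (1 - l) * (1 - l * y))"
    have z: "1 - z = (1 - y) / (1 - l * y)" "1 - m * z = 1 / (1 - l * y)"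
      using sub'[OF y] unfolding z_def by simp_all
    show "z / ((1 - l) * (1 - m * z)) = y"
      unfolding z(2) using y l' by (simp add: z_def)
    then have yz: "y = z / ((1 - l) * (1 - m * z))" by simp
    show z': "z \<in> {z. 1 - m * z \<noteq> 0}" unfolding mem_Collect_eq z(2) using y by simp
    then have w: "1 - m * z \<noteq> 0" by simp
    note s = sub[OF w, folded yz]
    have "f y = A (z / ((1 - l) * (1 - m * z))) *
        (C \<odot> char_inv A) ((1 - z) / (1 - m * z)) * char_inv B (1 / (1 - m * z))"
      unfolding f_def s by (simp flip: yz)
    also have "\<dots> = g z"
      using mult_character_nonzero[OF A w] mult_character_nonzero[OF B w]
        mult_character_nonzero[OF C w] mult_character_nonzero[OF A l'(1)]
      unfolding g_def char_mult_def char_inv_def mult_character_divide[OF A]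
        mult_character_divide[OF B] mult_character_divide[OF C] mult_character_mult[OF A]
        mult_character_one[OF B]
      by (simp add: divide_simps)
    finally show "g z = f y" by simp
  next
    fix z assume "z \<in> {z. 1 - m * z \<noteq> 0}"
    then have z: "1 - m * z \<noteq> 0" by simp
    define y where "y = z / ((1 - l) * (1 - m * z))"
    have y: "1 - l * y = 1 / (1 - m * z)" using sub[OF z] by (simp add: y_def)
    show "y / (1 / (1 - l) * (1 - l * y)) = z"
      unfolding y using z l' by (simp add: y_def)
    show "y \<in> {y. 1 - l * y \<noteq> 0}" unfolding mem_Collect_eq y using z by simp
  qed
  also have "\<dots> = sum g UNIV"
    by (rule sum.mono_neutral_left) (use g0 in auto)
  finally show ?thesis
    by (simp add: lauricella_period_def f_def g_def m_def sum_distrib_left)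
qed

text \<open>The \<open>B\<close> factor now has the argument \<open>1 - y\<close> too, so it merges
  with the factor of \<open>C \<odot> char_inv A\<close>.\<close>

lemma lauricella_period_at_one:
  fixes A B C :: "'a::{finite,field} \<Rightarrow> complex"
  shows "lauricella_period 1 A (\<lambda>_. B) C (\<lambda>_. 1) = jacobi_sum A (C \<odot> char_inv (A \<odot> B))"
  by (simp add: lauricella_period_def jacobi_sum_def char_mult_def char_inv_def mult.assoc)

theorem proposition6p5:
  fixes p e :: nat
  assumes "prime p" and "odd p" and "CARD('a::{finite,field}) = p ^ e"
  shows
    "(\<forall>(A :: 'a \<Rightarrow> complex) B C (l :: 'a).
        mult_character A \<longrightarrow> mult_character B \<longrightarrow> mult_character C \<longrightarrow>
          lauricella_period 1 A (\<lambda>_. B) C (\<lambda>_. l) =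
            char_inv B (1 - l) *
              lauricella_period 1 (char_inv A \<odot> C) (\<lambda>_. B) C (\<lambda>_. l / (l - 1)) +
            delta (1 - l) * jacobi_sum A (C \<odot> char_inv (A \<odot> B)) \<and>
          lauricella_period 1 A (\<lambda>_. B) C (\<lambda>_. l) =
            char_inv A (1 - l) *
              lauricella_period 1 A (\<lambda>_. C \<odot> char_inv B) C (\<lambda>_. l / (l - 1)) +
            delta (1 - l) * jacobi_sum A (C \<odot> char_inv (A \<odot> B))) \<and>
     (\<forall>(n :: nat) (A :: 'a \<Rightarrow> complex) C (B :: nat \<Rightarrow> 'a \<Rightarrow> complex) (l :: nat \<Rightarrow> 'a).
        n \<ge> 2 \<longrightarrow> mult_character A \<longrightarrow> mult_character C \<longrightarrow>
        (\<forall>i\<in>{1..n}. mult_character (B i)) \<longrightarrow> (\<forall>i\<in>{1..n}. l i \<noteq> 1) \<longrightarrow>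
          lauricella_period n A B C l =
            (\<Prod>i=1..n. char_inv (B i) (1 - l i)) *
              lauricella_period n (char_inv A \<odot> C) B C (\<lambda>i. l i / (l i - 1)))"
proof (intro conjI allI impI)
  fix A B C :: "'a \<Rightarrow> complex" and l :: 'a
  assume A: "mult_character A" and B: "mult_character B" and C: "mult_character C"
  show "lauricella_period 1 A (\<lambda>_. B) C (\<lambda>_. l) =
      char_inv B (1 - l) * lauricella_period 1 (char_inv A \<odot> C) (\<lambda>_. B) C (\<lambda>_. l / (l - 1)) +
      delta (1 - l) * jacobi_sum A (C \<odot> char_inv (A \<odot> B))"
  \<comment> \<open>At \<open>l = 1\<close> the quotient \<open>l / (l - 1)\<close> takes the
    default value 0, but its period is multiplied by \<open>char_inv B 0 = 0\<close>. Only the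
    Jacobi sum remains, as the convention in the statement demands.\<close>
  proof (cases "l = 1")
    case True
    then show ?thesis
      using lauricella_period_at_one[of A B C] B
      by (simp add: delta_def char_inv_def mult_character_zero)
  next
    case False
    then show ?thesis
      using lauricella_period_reflect[OF A C, of 1 "\<lambda>_. B" "\<lambda>_. l"] B by (simp add: delta_def)
  qed
  show "lauricella_period 1 A (\<lambda>_. B) C (\<lambda>_. l) =
      char_inv A (1 - l) * lauricella_period 1 A (\<lambda>_. C \<odot> char_inv B) C (\<lambda>_. l / (l - 1)) +
      delta (1 - l) * jacobi_sum A (C \<odot> char_inv (A \<odot> B))"
  proof (cases "l = 1")
    case True
    then show ?thesis
      using lauricella_period_at_one[of A B C] A
      by (simp add: delta_def char_inv_def mult_character_zero)
  next
    case False
    then show ?thesis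
      using lauricella_period_moebius[OF A B C] by (simp add: delta_def)
  qed
qed (rule lauricella_period_reflect)

end
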